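(* Let $f(X)\in\mathbb{F}_q[X]$ be a nonconstant squarefree polynomial coprime to $X$, with order $m$ and primitive defining set $T_f\subseteq\mathbb{Z}/m\mathbb{Z}$. Let $d$ be the largest divisor of $m$ such that there exists an equal-difference subset $E\subseteq\mathbb{Z}/m\mathbb{Z}$ defined over $\mathbb{F}_q$ with common difference $d$ containing $T_f$ (such $d$ and $E$ exist and $E$ is unique). Then the polynomial $f_E(X)=\prod_{\gamma\in E}(X-\zeta_m^{\gamma})$ is the minimal binomial multiple of $f$. In particular, $\frac md$ is the minimal binomial order of $f$.
   Context: $\mathrm{ord}(g)$ is the least positive $m$ with $g\mid X^m-1$. $\{\zeta_n:\gcd(n,q)=1\}$ is a fixed compatible family of primitive roots of unity ($\zeta_n^{n/k}=\zeta_k$ for $k\mid n$). The primitive defining set of squarefree $g$ of order $m$ is $T_g\subseteq\mathbb{Z}/m\mathbb{Z}$ with $g=a\prod_{\gamma\in T_g}(X-\zeta_m^\gamma)$, $a\in\mathbb{F}_q^\ast$. An equal-difference subset of $\mathbb{Z}/m\mathbb{Z}$ with common difference $d$ (a positive divisor of $m$) is $\{\gamma,\gamma+d,\dots,\gamma+(\tfrac md-1)d\}$; it is defined over $\mathbb{F}_q$ if $\gamma q\equiv\gamma\pmod d$. A binomial is $X^n-\lambda$ with $n\ge1$, $\lambda\in\mathbb{F}_q^\ast$; the minimal binomial multiple of $f$ is the monic binomial over $\mathbb{F}_q$ of least degree divisible by $f$, and its degree is the minimal binomial order. *)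

theory Defs
  imports
    "HOL-Algebra.Algebraic_Closure_Type"
    "HOL-Computational_Algebra.Computational_Algebra"
    "HOL-Library.Cardinality"
    "HOL-Number_Theory.Cong"
begin

text \<open>
  The field with \<open>q\<close> elements is a type \<open>'a\<close> of sort \<open>{field, finite}\<close>, with \<open>q = CARD('a)\<close>;
  roots of unity live in its algebraic closure \<open>'a alg_closure\<close>, with embedding \<open>to_ac\<close>.
  Residue classes modulo \<open>m\<close> are represented by their least nonnegative representatives,
  so subsets of \<open>\<int>/m\<int>\<close> are subsets of \<open>{..<m}\<close>.
\<close>

definition primitive_root_of_unity :: "nat \<Rightarrow> 'b::field \<Rightarrow> bool" where
  "primitive_root_of_unity n z \<longleftrightarrow>
     n > 0 \<and> z ^ n = 1 \<and> (\<forall>k. 0 < k \<and> k < n \<longrightarrow> z ^ k \<noteq> 1)"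

text \<open>
  Only the values \<open>\<zeta> n\<close> with \<open>n\<close> coprime to \<open>q\<close> are constrained. As \<open>q \<ge> 2\<close>, this excludes \<open>n = 0\<close>.
\<close>

definition compatible_roots_of_unity :: "(nat \<Rightarrow> 'a::{field,finite} alg_closure) \<Rightarrow> bool" where
  "compatible_roots_of_unity \<zeta> \<longleftrightarrow>
     (\<forall>n. coprime n CARD('a) \<longrightarrow>
        primitive_root_of_unity n (\<zeta> n) \<and> (\<forall>k. k dvd n \<longrightarrow> \<zeta> n ^ (n div k) = \<zeta> k))"

definition poly_ord :: "'a::{field,finite} poly \<Rightarrow> nat" where
  "poly_ord g = (LEAST m. m > 0 \<and> g dvd (monom 1 m - 1))"

definition root_product :: "(nat \<Rightarrow> 'b::field) \<Rightarrow> nat \<Rightarrow> nat set \<Rightarrow> 'b poly" where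
  "root_product \<zeta> m S = (\<Prod>\<gamma>\<in>S. [:- (\<zeta> m ^ \<gamma>), 1:])"

definition is_primitive_defining_set ::
  "(nat \<Rightarrow> 'a::{field,finite} alg_closure) \<Rightarrow> 'a poly \<Rightarrow> nat set \<Rightarrow> bool" where
  "is_primitive_defining_set \<zeta> g T \<longleftrightarrow>
     T \<subseteq> {..<poly_ord g} \<and>
     (\<exists>a. a \<noteq> 0 \<and> map_poly to_ac g = smult (to_ac a) (root_product \<zeta> (poly_ord g) T))"

definition arith_subset :: "nat \<Rightarrow> nat \<Rightarrow> nat \<Rightarrow> nat set" where
  "arith_subset m d \<gamma> = (\<lambda>i. (\<gamma> + i * d) mod m) ` {..<m div d}"

definition equal_difference_subset :: "nat \<Rightarrow> nat \<Rightarrow> nat set \<Rightarrow> bool" where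
  "equal_difference_subset m d E \<longleftrightarrow>
     d > 0 \<and> d dvd m \<and> (\<exists>\<gamma><m. E = arith_subset m d \<gamma>)"

text \<open>
  The congruence does not depend on the choice of the initial term \<open>\<gamma>\<close>: any two choices agree
  modulo \<open>d\<close>.
\<close>

definition defined_over :: "nat \<Rightarrow> nat \<Rightarrow> nat \<Rightarrow> nat set \<Rightarrow> bool" where
  "defined_over q m d E \<longleftrightarrow> (\<exists>\<gamma><m. E = arith_subset m d \<gamma> \<and> [\<gamma> * q = \<gamma>] (mod d))"

definition equal_difference_cover :: "nat \<Rightarrow> nat \<Rightarrow> nat set \<Rightarrow> nat \<Rightarrow> nat set \<Rightarrow> bool" where
  "equal_difference_cover q m T d E \<longleftrightarrow>
     equal_difference_subset m d E \<and> defined_over q m d E \<and> T \<subseteq> E"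

definition largest_common_difference :: "nat \<Rightarrow> nat \<Rightarrow> nat set \<Rightarrow> nat \<Rightarrow> bool" where
  "largest_common_difference q m T d \<longleftrightarrow>
     (\<exists>E. equal_difference_cover q m T d E) \<and>
     (\<forall>d'. (\<exists>E. equal_difference_cover q m T d' E) \<longrightarrow> d' \<le> d)"

definition is_binomial :: "'a::field poly \<Rightarrow> bool" where
  "is_binomial p \<longleftrightarrow> (\<exists>n c. n \<ge> 1 \<and> c \<noteq> 0 \<and> p = monom 1 n - [:c:])"

definition is_minimal_binomial_multiple :: "'a::field poly \<Rightarrow> 'a poly \<Rightarrow> bool" where
  "is_minimal_binomial_multiple f p \<longleftrightarrow>
     is_binomial p \<and> f dvd p \<and>
     (\<forall>p'. is_binomial p' \<and> f dvd p' \<longrightarrow> Polynomial.degree p \<le> Polynomial.degree p')"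

definition minimal_binomial_multiple :: "'a::field poly \<Rightarrow> 'a poly" where
  "minimal_binomial_multiple f = (THE p. is_minimal_binomial_multiple f p)"

definition minimal_binomial_order :: "'a::field poly \<Rightarrow> nat" where
  "minimal_binomial_order f = Polynomial.degree (minimal_binomial_multiple f)"

end

theory Submission
  imports Defs "HOL-Algebra.Sylow"
begin

text \<open>
  Squarefreeness makes \<open>m = ord f\<close> coprime to \<open>q\<close>: otherwise \<open>X\<^sup>m - 1 = (X\<^sup>k - 1)\<^sup>p\<close> with
  \<open>m = p * k\<close>, and \<open>f\<close> would already divide \<open>X\<^sup>k - 1\<close>. Hence \<open>\<zeta>\<^sub>m\<close> is a primitive root, and
  \<open>f\<close> divides \<open>X\<^sup>n - \<lambda>\<close> iff \<open>\<zeta>\<^sub>m\<close> raised to \<open>\<gamma> * n\<close> equals \<open>\<lambda>\<close> for all \<open>\<gamma> \<in> T\<close>.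
  For \<open>n = m / d\<close> this says that all of \<open>T\<close> lies in one class modulo \<open>d\<close>, while \<open>\<lambda>\<^sup>q = \<lambda>\<close> is
  the condition of being defined over the base field. As the least exponent \<open>n\<close> of a binomial
  multiple divides \<open>m\<close>, minimising \<open>n\<close> amounts to maximising \<open>d\<close>.
\<close>

section \<open>Finite fields\<close>

text \<open>Multiplication by a nonzero \<open>x\<close> permutes the nonzero elements and so
  preserves their product. The extra factor \<open>x\<close> in front turns the exponent
  \<open>CARD('a) - 1\<close> into \<open>CARD('a)\<close>.\<close>

lemma finite_field_power_CARD:
  fixes x :: "'a::{field,finite}"
  shows "x ^ CARD('a) = x"
proof (cases "x = 0")
  case False
  have "x * (\<Prod>y\<in>UNIV-{0}. x * y) = x * x ^ (CARD('a) - 1) * \<Prod>(UNIV-{0})"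
    by (simp add: prod.distrib mult_ac)
  also have "x * x ^ (CARD('a) - 1) = x ^ CARD('a)"
    by (simp add: power_eq_if)
  also have "(\<Prod>y\<in>UNIV-{0}. x * y) = (\<Prod>y\<in>UNIV-{0}. y)"
    by (rule prod.reindex_bij_witness[of _ "\<lambda>y. y / x" "\<lambda>y. x * y"]) (use False in auto)
  finally show ?thesis
    by simp
qed (simp add: zero_less_card_finite)

text \<open>Cauchy's theorem for the additive group, obtained from Sylow's theorem with exponent 1:
  some \<open>x \<noteq> 0\<close> satisfies \<open>of_nat p * x = 0\<close>, so \<open>p\<close>
  vanishes in the field and is a multiple of the characteristic.\<close>

lemma prime_dvd_CARD_eq_CHAR:
  assumes "Factorial_Ring.prime p" "p dvd CARD('a::{field,finite})"
  shows "p = CHAR('a)"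
proof -
  define G where "G = \<lparr>carrier = (UNIV :: 'a set), monoid.mult = (+), one = (0 :: 'a)\<rparr>"
  interpret G: group G
  proof (rule groupI)
    fix x assume "x \<in> carrier G"
    show "\<exists>y\<in>carrier G. y \<otimes>\<^bsub>G\<^esub> x = \<one>\<^bsub>G\<^esub>"
      by (intro bexI[of _ "-x"]) (auto simp: G_def)
  qed (auto simp: G_def add_ac)
  have pow: "x [^]\<^bsub>G\<^esub> n = of_nat n * x" for x and n :: nat
    by (induction n) (auto simp: G_def nat_pow_def algebra_simps)
  obtain k where k: "CARD('a) = p ^ 1 * k"
    using assms(2) by auto
  then have "Coset.order G = p ^ 1 * k"
    by (simp add: G_def Coset.order_def)
  then obtain H where H: "subgroup H G" "card H = p ^ 1"
    using sylow_thm[OF assms(1) G.is_group] by (metis G_def finite partial_object.select_convs(1))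
  have "\<not> H \<subseteq> {0}"
  proof
    assume "H \<subseteq> {0}"
    then have "card H \<le> card {0::'a}"
      by (intro card_mono) auto
    with H(2) prime_ge_2_nat[OF assms(1)] show False by simp
  qed
  then obtain x where x: "x \<in> H" "x \<noteq> 0"
    by auto
  interpret H: group "G\<lparr>carrier := H\<rparr>"
    using H(1) by (rule G.subgroup_imp_group)
  have "x [^]\<^bsub>G\<lparr>carrier := H\<rparr>\<^esub> Coset.order (G\<lparr>carrier := H\<rparr>) = \<one>\<^bsub>G\<^esub>"
    using H.pow_order_eq_1[of x] x(1) by simp
  then have "x [^]\<^bsub>G\<^esub> p = \<one>\<^bsub>G\<^esub>"
    using H(2) by (simp add: Coset.order_def nat_pow_def)
  then have "of_nat p * x = 0"
    unfolding pow by (simp add: G_def)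
  then have "of_nat p = (0 :: 'a)"
    using x(2) by simp
  then have "CHAR('a) dvd p"
    by (simp add: of_nat_eq_0_iff_char_dvd)
  with assms(1) show ?thesis
    using CHAR_not_1'[where 'a='a] by (metis One_nat_def prime_nat_iff)
qed

text \<open>With \<open>q = CARD('a)\<close>, the polynomial \<open>X^q - X\<close> has at most
  \<open>q\<close> roots in the closure, and the base field already supplies \<open>q\<close> of
  them.\<close>

lemma alg_closure_power_CARD_eq_imp_in_range:
  fixes y :: "'a::{field,finite} alg_closure"
  assumes "y ^ CARD('a) = y"
  shows "y \<in> range to_ac"
proof -
  let ?p = "monom 1 CARD('a) - monom 1 1 :: 'a alg_closure poly"
  \<comment> \<open>This keeps the two monomials of \<open>?p\<close> from cancelling.\<close>
  have card2: "CARD('a) \<ge> 2"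
    using card_mono[of UNIV "{0, 1 :: 'a}"] by simp
  have "Polynomial.coeff ?p CARD('a) = 1"
    using card2 by (simp add: coeff_monom)
  then have nz: "?p \<noteq> 0" by (metis coeff_0 zero_neq_one)
  have deg: "Polynomial.degree ?p \<le> CARD('a)"
    using card2 by (intro degree_diff_le) (auto simp: degree_monom_eq)
  have roots: "{x. poly ?p x = 0} = {x. x ^ CARD('a) = x}"
    by (auto simp: poly_monom)
  have "range to_ac \<subseteq> {x. poly ?p x = 0}"
    unfolding roots by (auto simp flip: to_ac_power simp: finite_field_power_CARD)
  moreover have "card {x. poly ?p x = 0} \<le> card (range (to_ac :: 'a \<Rightarrow> _))"
    using card_poly_roots_bound[OF nz] deg by (simp add: card_image inj_to_ac)
  ultimately have "range to_ac = {x. poly ?p x = 0}"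
    by (intro card_seteq poly_roots_finite nz)
  with assms roots show ?thesis by auto
qed

section \<open>Polynomials\<close>

text \<open>Induction on the primes: with \<open>g = prod_mset A * k\<close>, the next prime
  \<open>p\<close> divides \<open>g\<close> but, by squarefreeness, not \<open>prod_mset A\<close>.
  Hence it divides \<open>k\<close>.\<close>

lemma squarefree_prod_mset_dvd_power:
  fixes g :: "'b::algebraic_semidom"
  assumes "\<And>p. p \<in># A \<Longrightarrow> prime_elem p" "squarefree (prod_mset A)" "prod_mset A dvd g ^ n"
  shows "prod_mset A dvd g"
  using assms
proof (induction A)
  case (add p A)
  have p: "prime_elem p" using add.prems(1) by simp
  have "squarefree (prod_mset A)"
    using add.prems(2) by (auto dest: squarefree_multD)
  moreover have "prod_mset A dvd g ^ n"
    using add.prems(3) by (auto intro: dvd_mult_right)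
  ultimately have "prod_mset A dvd g"
    using add.prems(1) by (intro add.IH) auto
  then obtain k where k: "g = prod_mset A * k" by (rule dvdE)
  have "p dvd g ^ n"
    using add.prems(3) by (auto intro: dvd_mult_left)
  then have "p dvd prod_mset A * k"
    using p k prime_elem_dvd_power by metis
  moreover have "\<not> p dvd prod_mset A"
  proof
    assume "p dvd prod_mset A"
    then have "p ^ 2 dvd prod_mset (add_mset p A)"
      by (simp add: power2_eq_square mult_dvd_mono)
    with add.prems(2) have "is_unit p"
      by (auto dest: squarefreeD)
    with p show False by simp
  qed
  ultimately have "p dvd k"
    using p by (simp add: prime_elem_dvd_mult_iff)
  then show ?case
    using k by (simp add: mult.commute mult_dvd_mono)
qed auto

text \<open>Over a field, \<open>f\<close> is a product of primes up to a nonzero constant, which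
  divisibility does not see.\<close>

lemma squarefree_poly_dvd_power:
  fixes f g :: "'b::field poly"
  assumes "squarefree f" "f dvd g ^ n"
  shows "f dvd g"
proof -
  have "f \<noteq> 0" using assms(1) by auto
  obtain A where A: "prod_mset A = smult (inverse (lead_coeff f)) f"
    and prime: "\<And>p. p \<in># A \<Longrightarrow> prime_elem p"
    using that[OF field_poly_prod_mset_prime_factorization[OF \<open>f \<noteq> 0\<close>]
        field_poly_in_prime_factorization_imp_prime] .
  have dvd_iff: "prod_mset A dvd h \<longleftrightarrow> f dvd h" for h
    using \<open>f \<noteq> 0\<close> by (simp add: A smult_dvd_iff)
  have "prod_mset A dvd f"
    by (simp add: dvd_iff)
  then have "squarefree (prod_mset A)"
    using assms(1) by (rule squarefree_mono)
  then have "prod_mset A dvd g"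
    using prime assms(2) by (intro squarefree_prod_mset_dvd_power[of A g n]) (simp_all add: dvd_iff)
  then show ?thesis by (simp add: dvd_iff)
qed

section \<open>Existence of the order and its coprimality to the characteristic\<close>

lemma finite_bounded_degree_poly:
  "finite {p :: 'b::{zero,finite} poly. Polynomial.degree p < n}"
proof -
  have *: "p \<in> Poly ` {xs. length xs \<le> n}" if "Polynomial.degree p < n" for p :: "'b poly"
  proof
    show "p = Poly (coeffs p)" by simp
    show "coeffs p \<in> {xs. length xs \<le> n}"
      using that by (cases "p = 0") (auto simp: length_coeffs_degree)
  qed
  have "finite (Poly ` {xs :: 'b list. length xs \<le> n})"
    using finite_lists_length_le[of "UNIV :: 'b set" n] by simp
  then show ?thesis
    by (rule rev_finite_subset) (auto intro: *)
qed

text \<open>\<open>X\<close> is prime and does not divide \<open>f\<close>, so it divides the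
  cofactor and can be cancelled, one factor at a time.\<close>

lemma dvd_monom_mult_imp_dvd:
  fixes f g :: "'b::field poly"
  assumes "coprime f [:0, 1:]" "f dvd monom 1 k * g"
  shows "f dvd g"
  using assms(2)
proof (induction k)
  case (Suc k)
  have X: "prime_elem [:0, 1 :: 'b:]"
    by (rule prime_elem_linear_field_poly) simp
  obtain s where s: "[:0, 1:] * (monom 1 k * g) = f * s"
    using Suc.prems by (auto simp: dvd_def monom_Suc)
  have "\<not> [:0, 1:] dvd f"
    using assms(1) X by (meson coprime_common_divisor dvd_refl prime_elem_not_unit)
  moreover have "[:0, 1:] dvd f * s"
    by (metis s dvd_triv_left)
  ultimately have "[:0, 1:] dvd s"
    using X prime_elem_dvd_mult_iff by blast
  then obtain t where "s = [:0, 1:] * t" ..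
  with s have "[:0, 1:] * (monom 1 k * g) = [:0, 1:] * (f * t)"
    by (simp only: mult_ac)
  then have "monom 1 k * g = f * t"
    by (subst (asm) mult_left_cancel) auto
  then have "f dvd monom 1 k * g"
    by (rule dvdI)
  then show ?case
    by (rule Suc.IH)
qed simp

text \<open>Pigeonhole: only finitely many remainders modulo \<open>f\<close> exist, so two powers
  of \<open>X\<close> leave the same one. The smaller power is then cancelled from their
  difference.\<close>

lemma exists_poly_dvd_monom_minus_1:
  fixes f :: "'a::{field,finite} poly"
  assumes "Polynomial.degree f > 0" "coprime f [:0, 1:]"
  shows "\<exists>m>0. f dvd monom 1 m - 1"
proof -
  define r where "r k = monom 1 k mod f" for k
  have "range r \<subseteq> {p. Polynomial.degree p < Polynomial.degree f}"
  proof safe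
    fix k
    show "Polynomial.degree (r k) < Polynomial.degree f"
      using degree_mod_less[of f "monom 1 k"] assms(1) by (cases "f = 0") (auto simp: r_def)
  qed
  then have "finite (range r)"
    using finite_bounded_degree_poly by (rule finite_subset)
  then have "\<not> inj r"
    using infinite_UNIV_nat finite_imageD by blast
  then obtain i j where "i < j" "r i = r j"
    by (metis injI linorder_neqE_nat)
  then have "f dvd monom 1 j - monom 1 i"
    unfolding r_def by (metis mod_eq_dvd_iff)
  also have "monom 1 j - monom 1 i = monom 1 i * (monom 1 (j - i) - 1 :: 'a poly)"
    using \<open>i < j\<close> by (simp add: right_diff_distrib mult_monom)
  finally have "f dvd monom 1 (j - i) - 1"
    using assms(2) by (rule dvd_monom_mult_imp_dvd[rotated])
  with \<open>i < j\<close> show ?thesis by (intro exI[of _ "j - i"]) simp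
qed

lemma
  fixes f :: "'a::{field,finite} poly"
  assumes "Polynomial.degree f > 0" "coprime f [:0, 1:]"
  shows poly_ord_pos: "poly_ord f > 0"
    and dvd_monom_poly_ord: "f dvd monom 1 (poly_ord f) - 1"
  using LeastI_ex[OF exists_poly_dvd_monom_minus_1[OF assms]] unfolding poly_ord_def by auto

lemma coprime_poly_ord_CARD:
  fixes f :: "'a::{field,finite} poly"
  assumes "Polynomial.degree f > 0" "coprime f [:0, 1:]" "squarefree f"
  shows "coprime (poly_ord f) CARD('a)"
proof (rule ccontr)
  assume "\<not> coprime (poly_ord f) CARD('a)"
  then obtain p where p: "Factorial_Ring.prime p" "p dvd poly_ord f" "p dvd CARD('a)"
    by (metis coprime_iff_gcd_eq_1 gcd_greatest_iff prime_factor_nat)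
  have pC: "p = CHAR('a poly)"
    using prime_dvd_CARD_eq_CHAR[OF p(1,3)] by simp
  obtain k where k: "poly_ord f = p * k" using p(2) by auto
  have k0: "k > 0"
    using poly_ord_pos[OF assms(1,2)] k by (cases k) auto
  \<comment> \<open>Expanding \<open>X^k\<close> as \<open>(X^k - 1) + 1\<close> lets Frobenius act
    on a sum, which avoids the sign of \<open>(-1)^p\<close>.\<close>
  have "monom 1 (poly_ord f) = ((monom 1 k - 1) + 1 :: 'a poly) ^ p"
    by (simp add: k monom_power mult.commute)
  also have "\<dots> = (monom 1 k - 1) ^ p + 1"
    using freshmans_dream[of p "monom 1 k - 1 :: 'a poly" 1] p(1) pC by simp
  finally have "f dvd (monom 1 k - 1) ^ p"
    using dvd_monom_poly_ord[OF assms(1,2)] by simp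
  then have "f dvd monom 1 k - 1"
    by (rule squarefree_poly_dvd_power[OF assms(3)])
  then have "poly_ord f \<le> k"
    using k0 unfolding poly_ord_def by (intro Least_le) simp
  moreover have "2 * k \<le> p * k"
    using prime_ge_2_nat[OF p(1)] by simp
  ultimately show False
    using k k0 by linarith
qed

section \<open>Base change to the algebraic closure\<close>

lemma map_poly_to_ac_mult:
  "map_poly to_ac (p * r) = map_poly to_ac p * map_poly to_ac r"
  by (rule poly_eqI) (simp add: coeff_map_poly coeff_mult to_ac_sum)

lemma map_poly_to_ac_add:
  "map_poly to_ac (p + r) = map_poly to_ac p + map_poly to_ac r"
  by (rule poly_eqI) (simp add: coeff_map_poly)

lemma degree_map_poly_to_ac [simp]:
  "Polynomial.degree (map_poly to_ac p) = Polynomial.degree p"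
  by (cases "p = 0") (simp_all add: map_poly_degree_eq)

text \<open>Division with remainder survives base change, and so do degrees. Divisibility in the
  closure therefore forces the remainder, which is of smaller degree, to vanish.\<close>

lemma map_poly_to_ac_dvd_iff:
  "map_poly to_ac p dvd map_poly to_ac r \<longleftrightarrow> p dvd r"
proof
  assume "p dvd r"
  then show "map_poly to_ac p dvd map_poly to_ac r"
    by (auto simp: dvd_def map_poly_to_ac_mult)
next
  assume dvd: "map_poly to_ac p dvd map_poly to_ac r"
  have "map_poly to_ac r = map_poly to_ac p * map_poly to_ac (r div p) + map_poly to_ac (r mod p)"
    by (simp flip: map_poly_to_ac_mult map_poly_to_ac_add)
  with dvd have "map_poly to_ac p dvd map_poly to_ac (r mod p)"
    by (metis dvd_add_right_iff dvd_triv_left)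
  then have "map_poly to_ac (r mod p) = 0 \<or> Polynomial.degree p \<le> Polynomial.degree (r mod p)"
    using dvd_imp_degree_le degree_map_poly_to_ac by metis
  moreover have "p = 0 \<or> r mod p = 0 \<or> Polynomial.degree (r mod p) < Polynomial.degree p"
    using degree_mod_less by blast
  \<comment> \<open>For \<open>p = 0\<close> no degree bound is available, but then
    \<open>dvd\<close> itself gives \<open>r = 0\<close>.\<close>
  ultimately have "r mod p = 0"
    using dvd by (auto simp: map_poly_eq_0_iff)
  then show "p dvd r" by (simp add: dvd_eq_mod_eq_0)
qed

lemma map_poly_to_ac_binomial:
  "map_poly to_ac (monom 1 n - [:c:]) = monom 1 n - [:to_ac c:]"
  by (rule poly_eqI) (auto simp: coeff_map_poly coeff_pCons split: nat.split)

section \<open>Products of distinct linear factors\<close>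

text \<open>Split off the root \<open>z a\<close>; by injectivity the other values differ from it
  and remain roots of the quotient.\<close>

lemma prod_linear_dvd_iff:
  fixes p :: "'b::field poly"
  assumes "finite S" "inj_on z S"
  shows "(\<Prod>x\<in>S. [:- z x, 1:]) dvd p \<longleftrightarrow> (\<forall>x\<in>S. poly p (z x) = 0)"
  using assms
proof (induction arbitrary: p)
  case (insert a S)
  show ?case
  proof
    assume "(\<Prod>x\<in>insert a S. [:- z x, 1:]) dvd p"
    then have "[:- z a, 1:] * (\<Prod>x\<in>S. [:- z x, 1:]) dvd p"
      by (simp only: prod.insert[OF insert.hyps])
    then have "[:- z a, 1:] dvd p" "(\<Prod>x\<in>S. [:- z x, 1:]) dvd p"
      by (rule dvd_mult_left, rule dvd_mult_right)
    then show "\<forall>x\<in>insert a S. poly p (z x) = 0"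
      using insert.IH[of p] insert.prems by (auto simp: poly_eq_0_iff_dvd)
  next
    assume *: "\<forall>x\<in>insert a S. poly p (z x) = 0"
    then obtain r where r: "p = [:- z a, 1:] * r"
      by (auto simp: poly_eq_0_iff_dvd dvd_def)
    have "\<forall>x\<in>S. poly r (z x) = 0"
      using * r insert.hyps insert.prems by (auto simp: inj_on_def)
    then have "(\<Prod>x\<in>S. [:- z x, 1:]) dvd r"
      using insert by auto
    then show "(\<Prod>x\<in>insert a S. [:- z x, 1:]) dvd p"
      unfolding r using insert.hyps by (simp del: mult_pCons_left add: mult_dvd_mono)
  qed
qed auto

lemma degree_binomial: "n \<ge> 1 \<Longrightarrow> Polynomial.degree (monom 1 n - [:c:] :: 'b::field poly) = n"
  by (subst diff_conv_add_uminus, subst degree_add_eq_left) (auto simp: degree_monom_eq)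

text \<open>Both sides are monic of degree \<open>card S\<close> and vanish at the same
  \<open>card S\<close> distinct points.\<close>

lemma prod_linear_eq_binomial:
  fixes z :: "'c \<Rightarrow> 'b::field"
  assumes "finite S" "inj_on z S" "\<And>x. x \<in> S \<Longrightarrow> z x ^ card S = c" "S \<noteq> {}"
  shows "(\<Prod>x\<in>S. [:- z x, 1:]) = monom 1 (card S) - [:c:]"
proof -
  have n: "card S \<ge> 1" using assms by (simp add: Suc_le_eq card_gt_0_iff)
  let ?p = "\<Prod>x\<in>S. [:- z x, 1:]"
  have deg: "Polynomial.degree ?p = card S"
    by (subst degree_prod_eq_sum_degree) auto
  have "lead_coeff ?p = 1"
    by (simp add: lead_coeff_prod)
  then show ?thesis
    using assms n deg degree_binomial[OF n, of c]
    by (intro poly_eqI_degree_lead_coeff[of _ "card S" _ "z ` S"])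
       (auto simp: card_image poly_prod poly_monom coeff_pCons split: nat.split)
qed

section \<open>Roots of unity and residue classes\<close>

lemma primitive_root_of_unity_power_eq_1_iff:
  assumes "primitive_root_of_unity m z"
  shows "z ^ k = 1 \<longleftrightarrow> m dvd k"
proof
  assume "z ^ k = 1"
  have "z ^ k = z ^ (m * (k div m) + k mod m)" by simp
  also have "\<dots> = z ^ (k mod m)"
    using assms unfolding power_add power_mult primitive_root_of_unity_def by simp
  finally have "\<not> 0 < k mod m"
    using assms \<open>z ^ k = 1\<close> unfolding primitive_root_of_unity_def
    by (metis mod_less_divisor)
  then show "m dvd k" by auto
qed (use assms in \<open>auto simp: primitive_root_of_unity_def power_mult\<close>)

lemma primitive_root_of_unity_power_eq_iff:
  assumes "primitive_root_of_unity m z"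
  shows "z ^ i = z ^ j \<longleftrightarrow> [i = j] (mod m)"
proof (induction i j rule: linorder_wlog)
  case (le i j)
  have "z \<noteq> 0"
    using assms by (auto simp: primitive_root_of_unity_def power_0_left)
  have "z ^ i = z ^ j \<longleftrightarrow> z ^ (j - i) = 1"
    using le \<open>z \<noteq> 0\<close> by (auto simp: power_diff)
  also have "\<dots> \<longleftrightarrow> [j = i] (mod m)"
    using le by (simp add: primitive_root_of_unity_power_eq_1_iff[OF assms] cong_altdef_nat)
  finally show ?case by (simp add: cong_sym_eq)
qed (auto simp: cong_sym_eq eq_commute)

lemma cong_mult_mult_right_iff:
  fixes k :: nat
  assumes "k > 0"
  shows "[x * k = y * k] (mod d * k) \<longleftrightarrow> [x = y] (mod d)"
  using assms by (simp add: cong_def flip: mult_mod_left)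

text \<open>In effect, \<open>z ^ k\<close> is a primitive \<open>d\<close>-th root of unity. This
  translates equal powers of roots of \<open>f\<close> into congruences modulo a common
  difference.\<close>

lemma primitive_root_of_unity_power_mult_eq_iff:
  assumes "primitive_root_of_unity m z" "m = d * k"
  shows "z ^ (x * k) = z ^ (y * k) \<longleftrightarrow> [x = y] (mod d)"
proof -
  have "k > 0"
    using assms by (auto simp: primitive_root_of_unity_def)
  then show ?thesis
    using primitive_root_of_unity_power_eq_iff[OF assms(1), of "x * k" "y * k"]
    by (simp add: assms(2) cong_mult_mult_right_iff)
qed

section \<open>Equal-difference subsets as residue classes\<close>

text \<open>Since \<open>d\<close> divides \<open>m\<close>, wrapping around modulo \<open>m\<close>
  stays in the class of \<gamma> modulo \<open>d\<close>. In this form only that class of the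
  initial term matters.\<close>

lemma arith_subset_eq:
  assumes "d > 0" "d dvd m" "\<gamma> < m"
  shows "arith_subset m d \<gamma> = {x. x < m \<and> [x = \<gamma>] (mod d)}"
proof (intro Set.set_eqI iffI)
  fix x assume "x \<in> arith_subset m d \<gamma>"
  then obtain i where "x = (\<gamma> + i * d) mod m"
    by (auto simp: arith_subset_def)
  then show "x \<in> {x. x < m \<and> [x = \<gamma>] (mod d)}"
    using assms by (auto simp: cong_def mod_mod_cancel)
next
  fix x assume "x \<in> {x. x < m \<and> [x = \<gamma>] (mod d)}"
  then have x: "x < m" "[x = \<gamma>] (mod d)" by auto
  have "\<exists>i. (\<gamma> + i * d) mod m = x"
  proof (cases "\<gamma> \<le> x")
    case True
    then obtain i where "x - \<gamma> = d * i"
      using x(2) by (auto simp: cong_altdef_nat)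
    then have "\<gamma> + i * d = x" using True by (simp add: mult.commute)
    then show ?thesis using x(1) by (intro exI[of _ i]) simp
  next
    case False
    \<comment> \<open>Elements below \<gamma> are reached after wrapping around; adding
      \<open>m\<close> makes the difference to \<gamma> a true natural number.\<close>
    have "[x + m = \<gamma>] (mod d)"
      using x(2) assms(2) by (simp add: cong_def mod_add_right_eq[symmetric, of x m]
        del: mod_add_right_eq)
    then obtain i where "x + m - \<gamma> = d * i"
      using assms(3) by (auto simp: cong_altdef_nat)
    then have "\<gamma> + i * d = x + m" using assms(3) by (simp add: mult.commute)
    then show ?thesis using x(1) by (intro exI[of _ i]) simp
  qed
  then obtain i where i: "(\<gamma> + i * d) mod m = x" ..
  \<comment> \<open>The index found so far may be too large; reducing it modulo
    \<open>m div d\<close> changes \<open>i * d\<close> only by a multiple of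
    \<open>m\<close>.\<close>
  have "[i * d = i mod (m div d) * d] (mod m)"
    using assms(2) by (simp add: cong_def mult_mod_left)
  then have "(\<gamma> + i mod (m div d) * d) mod m = x"
    using i by (metis cong_add_lcancel_nat cong_def)
  moreover have "m div d > 0"
    using assms by (auto simp: div_greater_zero_iff dvd_imp_le)
  ultimately show "x \<in> arith_subset m d \<gamma>"
    unfolding arith_subset_def by force
qed

text \<open>For \<open>i < m div d\<close> the multiples \<open>i * d\<close> stay below
  \<open>m\<close>, so reduction modulo \<open>m\<close> identifies no two terms.\<close>

lemma card_arith_subset:
  assumes "d > 0" "d dvd m"
  shows "card (arith_subset m d \<gamma>) = m div d"
proof -
  have "inj_on (\<lambda>i. (\<gamma> + i * d) mod m) {..<m div d}"
  proof (rule inj_onI)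
    fix i j assume ij: "i \<in> {..<m div d}" "j \<in> {..<m div d}"
      and "(\<gamma> + i * d) mod m = (\<gamma> + j * d) mod m"
    then have "(i * d) mod m = (j * d) mod m"
      by (metis cong_add_lcancel_nat cong_def)
    moreover have "k * d < m" if "k < m div d" for k
      using that assms by (auto simp: dvd_def)
    ultimately show "i = j" using ij assms(1) by simp
  qed
  then show ?thesis by (simp add: arith_subset_def card_image)
qed

text \<open>Fixing a member \<open>t\<close> of \<open>T\<close> makes \<open>E\<close> a function of \<open>d\<close>, which yields its uniqueness.\<close>

lemma equal_difference_cover_iff:
  assumes "T \<subseteq> {..<m}" "t \<in> T"
  shows "equal_difference_cover q m T d E \<longleftrightarrow>
    E = arith_subset m d t \<and> d > 0 \<and> d dvd m \<and> [t * q = t] (mod d) \<and> (\<forall>x\<in>T. [x = t] (mod d))"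
    (is "?L \<longleftrightarrow> ?R")
proof
  assume ?L
  then obtain \<gamma> where d: "d > 0" "d dvd m" and \<gamma>: "\<gamma> < m" "E = arith_subset m d \<gamma>"
      "[\<gamma> * q = \<gamma>] (mod d)" and TE: "T \<subseteq> E"
    by (auto simp: equal_difference_cover_def equal_difference_subset_def defined_over_def)
  have E: "E = {x. x < m \<and> [x = \<gamma>] (mod d)}"
    using arith_subset_eq d \<gamma> by simp
  have "t < m" and t: "[t = \<gamma>] (mod d)"
    using assms(2) TE E by auto
  have "[t * q = \<gamma> * q] (mod d)"
    using t by (rule cong_scalar_right)
  then have "[t * q = t] (mod d)"
    using \<gamma>(3) t by (meson cong_sym cong_trans)
  moreover have "E = arith_subset m d t"
    using E t arith_subset_eq[OF d \<open>t < m\<close>] by (auto simp: cong_def)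
  moreover have "\<forall>x\<in>T. [x = t] (mod d)"
    using TE E t by (auto simp: cong_def)
  ultimately show ?R using d by simp
next
  assume R: ?R
  then show ?L
    using assms arith_subset_eq[of d m t]
    by (auto simp: equal_difference_cover_def equal_difference_subset_def defined_over_def)
qed

section \<open>Binomial multiples\<close>

text \<open>Over the closure, \<open>f\<close> is a constant times a product of distinct linear
  factors, so divisibility amounts to evaluating the binomial at each root.\<close>

lemma dvd_binomial_iff:
  fixes f :: "'a::{field,finite} poly"
  assumes prim: "primitive_root_of_unity (poly_ord f) (\<zeta> (poly_ord f))"
    and T: "is_primitive_defining_set \<zeta> f T"
  shows "f dvd monom 1 n - [:c:] \<longleftrightarrow> (\<forall>\<gamma>\<in>T. \<zeta> (poly_ord f) ^ (\<gamma> * n) = to_ac c)"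
proof -
  let ?m = "poly_ord f"
  obtain a where Tm: "T \<subseteq> {..<?m}" and a: "a \<noteq> 0"
      "map_poly to_ac f = smult (to_ac a) (root_product \<zeta> ?m T)"
    using T by (auto simp: is_primitive_defining_set_def)
  have inj: "inj_on (\<lambda>\<gamma>. \<zeta> ?m ^ \<gamma>) T"
  proof (rule inj_onI)
    fix x y assume "x \<in> T" "y \<in> T" "\<zeta> ?m ^ x = \<zeta> ?m ^ y"
    then have "x < ?m" "y < ?m" "[x = y] (mod ?m)"
      using Tm by (auto simp: primitive_root_of_unity_power_eq_iff[OF prim])
    then show "x = y" by (simp add: cong_def)
  qed
  have "finite T" using Tm by (rule finite_subset) simp
  have "f dvd monom 1 n - [:c:] \<longleftrightarrow> root_product \<zeta> ?m T dvd monom 1 n - [:to_ac c:]"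
    by (subst map_poly_to_ac_dvd_iff[symmetric])
       (use a in \<open>simp add: map_poly_to_ac_binomial smult_dvd_iff\<close>)
  also have "\<dots> \<longleftrightarrow> (\<forall>\<gamma>\<in>T. \<zeta> ?m ^ (\<gamma> * n) = to_ac c)"
    unfolding root_product_def prod_linear_dvd_iff[OF \<open>finite T\<close> inj]
    by (simp add: poly_monom power_mult)
  finally show ?thesis .
qed

text \<open>All roots indexed by the subset share one \<open>(m div d)\<close>-th power. The
  congruence for \<open>t\<close> makes that value Frobenius-invariant, hence an element of the base
  field. There are exactly \<open>m div d\<close> such roots, so they exhaust the roots of the
  binomial.\<close>

lemma root_product_arith_subset:
  fixes \<zeta> :: "nat \<Rightarrow> 'a::{field,finite} alg_closure"
  assumes prim: "primitive_root_of_unity m (\<zeta> m)"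
    and d: "d > 0" "d dvd m" and t: "t < m" "[t * CARD('a) = t] (mod d)"
  obtains c where "c \<noteq> 0" "to_ac c = \<zeta> m ^ (t * (m div d))"
    "root_product \<zeta> m (arith_subset m d t) = map_poly to_ac (monom 1 (m div d) - [:c:])"
proof -
  let ?z = "\<zeta> m" and ?E = "arith_subset m d t"
  have "m = d * (m div d)" using d by simp
  then have shift: "?z ^ (x * (m div d)) = ?z ^ (y * (m div d))" if "[x = y] (mod d)" for x y
    using that by (simp only: primitive_root_of_unity_power_mult_eq_iff[OF prim])
  let ?y = "?z ^ (t * (m div d))"
  have "?y ^ CARD('a) = ?z ^ (t * CARD('a) * (m div d))"
    by (simp add: mult_ac flip: power_mult)
  also have "\<dots> = ?y" using t(2) by (rule shift)
  finally have "?y \<in> range to_ac"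
    by (rule alg_closure_power_CARD_eq_imp_in_range)
  then obtain c where c: "?y = to_ac c" ..
  have "?z \<noteq> 0"
    using prim by (auto simp: primitive_root_of_unity_def power_0_left)
  then have "c \<noteq> 0" using c by auto
  have E: "?E = {x. x < m \<and> [x = t] (mod d)}"
    by (rule arith_subset_eq) fact+
  have card: "card ?E = m div d"
    by (rule card_arith_subset) fact+
  have "finite ?E" by (simp add: arith_subset_def)
  moreover have "inj_on (\<lambda>\<gamma>. ?z ^ \<gamma>) ?E"
    by (auto simp: E inj_on_def primitive_root_of_unity_power_eq_iff[OF prim] cong_def)
  moreover have "t \<in> ?E" using t(1) by (simp add: E)
  then have "?E \<noteq> {}" by blast
  moreover have "(?z ^ x) ^ card ?E = to_ac c" if "x \<in> ?E" for x
  proof -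
    have "[x = t] (mod d)" using that by (simp add: E)
    then show ?thesis
      by (simp only: card c[symmetric] shift flip: power_mult)
  qed
  ultimately have "root_product \<zeta> m ?E = monom 1 (card ?E) - [:to_ac c:]"
    unfolding root_product_def
    using prod_linear_eq_binomial[of ?E "\<lambda>\<gamma>. ?z ^ \<gamma>" "to_ac c"] by blast
  then have "root_product \<zeta> m ?E = map_poly to_ac (monom 1 (m div d) - [:c:])"
    by (simp only: card map_poly_to_ac_binomial)
  with \<open>c \<noteq> 0\<close> c[symmetric] show thesis by (rule that)
qed

text \<open>
  The exponents of binomial multiples are closed under remainders, and \<open>m\<close> is one of them,
  so the least exponent divides \<open>m\<close>.
\<close>

lemma minimal_binomial_exponent:
  fixes f :: "'a::{field,finite} poly"
  defines "m \<equiv> poly_ord f"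
  assumes f: "Polynomial.degree f > 0" "coprime f [:0, 1:]"
    and prim: "primitive_root_of_unity m (\<zeta> m)"
    and T: "is_primitive_defining_set \<zeta> f T" and t: "t \<in> T"
    and n: "n \<ge> 1" "c \<noteq> 0" "f dvd monom 1 n - [:c:]"
    and least: "\<forall>n' c'. n' \<ge> 1 \<and> c' \<noteq> 0 \<and> f dvd monom 1 n' - [:c':] \<longrightarrow> n \<le> n'"
  shows "n dvd m" and "\<forall>x\<in>T. [x = t] (mod (m div n))" and "[t * CARD('a) = t] (mod (m div n))"
proof -
  let ?z = "\<zeta> m"
  note dvd_iff = dvd_binomial_iff[OF prim[unfolded m_def] T, folded m_def]
  have m: "m > 0" using poly_ord_pos[OF f] by (simp add: m_def)
  have zn: "?z ^ (x * n) = to_ac c" if "x \<in> T" for x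
    using n(3) that by (simp add: dvd_iff)
  have z1: "?z ^ m = 1" using prim by (simp add: primitive_root_of_unity_def)
  \<comment> \<open>The constant is forced by expanding \<open>1 = ?z ^ (x * m)\<close> along
    \<open>m = n * (m div n) + m mod n\<close>; it is the same for every
    \<open>x \<in> T\<close>.\<close>
  have "?z ^ (x * (m mod n)) = to_ac (inverse (c ^ (m div n)))" if "x \<in> T" for x
  proof -
    have "1 = (?z ^ m) ^ x" by (simp add: z1)
    also have "\<dots> = ?z ^ (x * (n * (m div n) + m mod n))"
      by (simp add: mult.commute flip: power_mult)
    also have "\<dots> = (?z ^ (x * n)) ^ (m div n) * ?z ^ (x * (m mod n))"
      by (simp only: distrib_left power_add mult.assoc flip: power_mult)
    also have "\<dots> = to_ac (c ^ (m div n)) * ?z ^ (x * (m mod n))"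
      using zn[OF that] by simp
    finally show ?thesis
      by (simp add: inverse_unique)
  qed
  then have "f dvd monom 1 (m mod n) - [:inverse (c ^ (m div n)):]"
    by (simp add: dvd_iff)
  moreover have "inverse (c ^ (m div n)) \<noteq> 0" and "m mod n < n"
    using n(1,2) by simp_all
  ultimately have "\<not> m mod n \<ge> 1"
    using least leD by blast
  then show "n dvd m" by (simp add: dvd_eq_mod_eq_0)
  then have mn: "m = (m div n) * n" by simp
  have cancel: "[x = y] (mod (m div n))" if "?z ^ (x * n) = ?z ^ (y * n)" for x y
    using that by (simp only: primitive_root_of_unity_power_mult_eq_iff[OF prim mn])
  show "\<forall>x\<in>T. [x = t] (mod (m div n))"
    using zn t by (intro ballI cancel) simp
  \<comment> \<open>The value \<open>?z ^ (t * n)\<close> lies in the base field, so Frobenius fixes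
    it; \<open>cancel\<close> turns this into the congruence.\<close>
  have "?z ^ (t * CARD('a) * n) = (?z ^ (t * n)) ^ CARD('a)"
    by (simp add: mult_ac flip: power_mult)
  also have "\<dots> = ?z ^ (t * n)"
    using zn[OF t] by (simp add: finite_field_power_CARD flip: to_ac_power)
  finally show "[t * CARD('a) = t] (mod (m div n))"
    by (rule cancel)
qed

text \<open>Two candidates have equal degree, so their difference is a constant divisible by the
  nonconstant \<open>f\<close>, hence zero. This justifies the definite description.\<close>

lemma minimal_binomial_multiple_eqI:
  fixes f :: "'a::field poly"
  assumes "Polynomial.degree f > 0" "is_minimal_binomial_multiple f p"
  shows "minimal_binomial_multiple f = p"
  unfolding minimal_binomial_multiple_def
proof (rule the_equality)
  fix r assume r: "is_minimal_binomial_multiple f r"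
  obtain n c n' c' where p: "n \<ge> 1" "p = monom 1 n - [:c:]" "n' \<ge> 1" "r = monom 1 n' - [:c':]"
    using assms(2) r by (auto simp: is_minimal_binomial_multiple_def is_binomial_def)
  have "Polynomial.degree p = Polynomial.degree r" "f dvd p" "f dvd r"
    using assms(2) r by (auto simp: is_minimal_binomial_multiple_def intro: order_antisym)
  moreover from this have "n = n'"
    using p by (simp add: degree_binomial)
  ultimately have "f dvd [:c' - c:]"
    using dvd_diff[of f p r] p by simp
  then have "c' - c = 0"
    using assms(1) dvd_imp_degree_le[of f "[:c' - c:]"] by auto
  with p \<open>n = n'\<close> show "r = p" by simp
qed fact

theorem theorem9:
  fixes f :: "'a::{field,finite} poly"
    and \<zeta> :: "nat \<Rightarrow> 'a alg_closure"
    and q m :: nat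
    and T :: "nat set"
  assumes "q = CARD('a)"
    and "compatible_roots_of_unity \<zeta>"
    and "Polynomial.degree f > 0"
    and "squarefree f"
    and "coprime f [:0, 1:]"
    and "m = poly_ord f"
    and "is_primitive_defining_set \<zeta> f T"
  shows "(\<exists>d. largest_common_difference q m T d) \<and>
    (\<forall>d. largest_common_difference q m T d \<longrightarrow>
       (\<exists>!E. equal_difference_cover q m T d E) \<and>
       (\<forall>E. equal_difference_cover q m T d E \<longrightarrow>
          is_minimal_binomial_multiple f (minimal_binomial_multiple f) \<and>
          map_poly to_ac (minimal_binomial_multiple f) = root_product \<zeta> m E \<and>
          minimal_binomial_order f = m div d))"
proof -
  note f = assms(3,5) and T = assms(7)
  have m: "m > 0" using poly_ord_pos[OF f] assms(6) by simp
  have prim: "primitive_root_of_unity m (\<zeta> m)"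
    using coprime_poly_ord_CARD[OF f assms(4)] assms(2,6)
    by (simp add: compatible_roots_of_unity_def)
  note dvd_iff = dvd_binomial_iff[OF prim[unfolded assms(6)] T, folded assms(6)]
  have Tm: "T \<subseteq> {..<m}" and "T \<noteq> {}"
  proof -
    show "T \<subseteq> {..<m}" using T assms(6) by (simp add: is_primitive_defining_set_def)
    \<comment> \<open>An empty product of linear factors would make \<open>f\<close>
      constant.\<close>
    show "T \<noteq> {}"
    proof
      assume "T = {}"
      then have "Polynomial.degree (map_poly to_ac f) = 0"
        using T by (auto simp: is_primitive_defining_set_def root_product_def
            simp del: degree_map_poly_to_ac)
      with f(1) show False by simp
    qed
  qed
  then obtain t where t: "t \<in> T" by auto
  then have "t < m" using Tm by auto
  \<comment> \<open>Once \<open>t\<close> is fixed, \<open>E\<close> is determined by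
    \<open>d\<close>; these are the conditions left on \<open>d\<close> alone.\<close>
  define good where
    "good d \<longleftrightarrow> d > 0 \<and> d dvd m \<and> [t * q = t] (mod d) \<and> (\<forall>x\<in>T. [x = t] (mod d))" for d
  have cover: "equal_difference_cover q m T d E \<longleftrightarrow> E = arith_subset m d t \<and> good d" for d E
    using equal_difference_cover_iff[OF Tm t] by (simp add: good_def)
  have largest: "largest_common_difference q m T d \<longleftrightarrow> good d \<and> (\<forall>d'. good d' \<longrightarrow> d' \<le> d)" for d
    by (auto simp: largest_common_difference_def cover)
  \<comment> \<open>Modulo 1 every condition is trivial, and divisors of \<open>m\<close> are
    bounded, so a largest good \<open>d\<close> exists.\<close>
  have "good 1" by (simp add: good_def)
  moreover have "d \<le> m" if "good d" for d
    using that m by (auto simp: good_def dvd_imp_le)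
  ultimately have "\<exists>d. largest_common_difference q m T d"
    using ex_has_greatest_nat[of good 1 "\<lambda>d. d" "Suc m"] by (auto simp: largest less_Suc_eq_le)
  moreover have "is_minimal_binomial_multiple f (minimal_binomial_multiple f) \<and>
      map_poly to_ac (minimal_binomial_multiple f) = root_product \<zeta> m (arith_subset m d t) \<and>
      minimal_binomial_order f = m div d" if "good d" and d_max: "\<And>d'. good d' \<Longrightarrow> d' \<le> d" for d
  proof -
    have d: "d > 0" "d dvd m" "[t * CARD('a) = t] (mod d)" "\<forall>x\<in>T. [x = t] (mod d)"
      using \<open>good d\<close> assms(1) by (auto simp: good_def)
    obtain c where c: "c \<noteq> 0" "to_ac c = \<zeta> m ^ (t * (m div d))"
      "root_product \<zeta> m (arith_subset m d t) = map_poly to_ac (monom 1 (m div d) - [:c:])"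
      using root_product_arith_subset[of m \<zeta> d t, OF prim d(1,2) \<open>t < m\<close> d(3)] by metis
    let ?p = "monom 1 (m div d) - [:c:]"
    have md: "m div d \<ge> 1"
      using m d(1,2) by (auto simp: dvd_def)
    have "m = d * (m div d)" using d(2) by simp
    then have "f dvd ?p"
      using d(4) primitive_root_of_unity_power_mult_eq_iff[OF prim] unfolding dvd_iff c(2) by blast
    have le: "m div d \<le> n'" if n': "n' \<ge> 1" "c' \<noteq> 0" "f dvd monom 1 n' - [:c':]" for n' c'
    proof -
      \<comment> \<open>The given exponent \<open>n'\<close> need not divide \<open>m\<close>, but
        the least exponent \<open>n\<close> does, and then \<open>m div n\<close> competes with
        \<open>d\<close>.\<close>
      define P where "P n \<longleftrightarrow> n \<ge> 1 \<and> (\<exists>c. c \<noteq> 0 \<and> f dvd monom 1 n - [:c:])" for n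
      define n where "n = (LEAST n. P n)"
      have "P n'" using n' by (auto simp: P_def)
      then have "P n" "n \<le> n'"
        unfolding n_def by (rule LeastI, rule Least_le)
      then obtain b where b: "n \<ge> 1" "b \<noteq> 0" "f dvd monom 1 n - [:b:]"
        by (auto simp: P_def)
      have least: "\<forall>k e. k \<ge> 1 \<and> e \<noteq> 0 \<and> f dvd monom 1 k - [:e:] \<longrightarrow> n \<le> k"
        unfolding n_def by (auto simp: P_def intro!: Least_le)
      note exponent = minimal_binomial_exponent[OF f prim[unfolded assms(6)] T t b least,
          folded assms(6)]
      have "m div n dvd m"
        using exponent(1) by (intro dvdI[of _ _ n]) simp
      moreover have "m div n > 0"
        using exponent(1) m by (auto simp: dvd_def)
      ultimately have "good (m div n)"
        using exponent assms(1) by (simp add: good_def)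
      then have "m div n \<le> d" by (rule d_max)
      \<comment> \<open>The left side is \<open>m\<close>, so dividing by \<open>d\<close> gives the
        bound on \<open>n\<close>.\<close>
      then have "m div n * n \<le> d * n"
        by (rule mult_le_mono1)
      then have "m div d \<le> d * n div d"
        using exponent(1) by (intro div_le_mono) simp
      then have "m div d \<le> n"
        using d(1) by simp
      with \<open>n \<le> n'\<close> show ?thesis by simp
    qed
    have "is_minimal_binomial_multiple f ?p"
      unfolding is_minimal_binomial_multiple_def is_binomial_def
      using md c(1) \<open>f dvd ?p\<close> le by (auto simp: degree_binomial)
    moreover from this have "minimal_binomial_multiple f = ?p"
      by (rule minimal_binomial_multiple_eqI[OF f(1)])
    ultimately show ?thesis
      using c(3) md by (simp add: minimal_binomial_order_def degree_binomial)
  qed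
  ultimately show ?thesis
    by (auto simp: largest cover)
qed

end
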